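(* Let $G$ be a finite simple graph with at least one vertex. For every proper coloring $c:V(G)\to[\chi(G)]$, every critical set $S$ for $(G,c)$ satisfies $|S|\le |V(G)|-1$.
   Context: $[k]=\{1,\dots,k\}$ and $\chi(G)$ is the chromatic number of $G=(V,E)$. For a proper coloring $c:V\to[\chi(G)]$, a determining set for $(G,c)$ is a set $S\subseteq V$ such that for every proper coloring $c':V\to[\chi(G)]$ of $G$, if $c'|_S=c|_S$ then $c'=c$ on all of $V$. A critical set for $(G,c)$ is a determining set for $(G,c)$ that is minimal under inclusion. *)

theory Defs
  imports "Graph_Theory.Pair_Digraph"
begin

text \<open>
  Finite simple graphs are those satisfying \<^locale>\<open>pair_graph\<close>: finite vertex set, and an
  irreflexive symmetric relation \<^const>\<open>parcs\<close> in which an edge uv is stored as both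
  ordered pairs (u, v) and (v, u). Colorings are total functions of which only the values on
  the vertices matter; accordingly they are only ever compared on \<^const>\<open>pverts\<close> or a subset.
\<close>

definition proper_coloring :: "'a pair_pre_digraph \<Rightarrow> nat \<Rightarrow> ('a \<Rightarrow> nat) \<Rightarrow> bool" where
  "proper_coloring G k c \<longleftrightarrow>
     c \<in> pverts G \<rightarrow> {1..k} \<and> (\<forall>(u, v) \<in> parcs G. c u \<noteq> c v)"

definition chromatic_number :: "'a pair_pre_digraph \<Rightarrow> nat" where
  "chromatic_number G = (LEAST k. \<exists>c. proper_coloring G k c)"

definition determining_set :: "'a pair_pre_digraph \<Rightarrow> ('a \<Rightarrow> nat) \<Rightarrow> 'a set \<Rightarrow> bool" where
  "determining_set G c S \<longleftrightarrow>
     S \<subseteq> pverts G \<and>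
     (\<forall>c'. proper_coloring G (chromatic_number G) c' \<longrightarrow>
       (\<forall>v\<in>S. c' v = c v) \<longrightarrow> (\<forall>v\<in>pverts G. c' v = c v))"

definition critical_set :: "'a pair_pre_digraph \<Rightarrow> ('a \<Rightarrow> nat) \<Rightarrow> 'a set \<Rightarrow> bool" where
  "critical_set G c S \<longleftrightarrow>
     determining_set G c S \<and> (\<forall>T. T \<subset> S \<longrightarrow> \<not> determining_set G c T)"

text \<open>The set minimised in \<^const>\<open>chromatic_number\<close> is nonempty, so the minimum is attained.\<close>

lemma (in pair_graph) ex_proper_coloring_chromatic_number:
  "\<exists>c. proper_coloring G (chromatic_number G) c"
proof -
  obtain f where f: "bij_betw f (pverts G) {1..card (pverts G)}"
    using ex_bij_betw_finite_nat [OF pair_finite_verts]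
      bij_betw_iff_card [OF pair_finite_verts, of "{1..card (pverts G)}"] by auto
  have "f u \<noteq> f v" if "(u, v) \<in> parcs G" for u v
  proof -
    have "u \<in> pverts G" "v \<in> pverts G" "u \<noteq> v"
      using that wellformed' pair_no_loops [OF that] by auto
    then show ?thesis
      using f by (auto simp: bij_betw_def inj_on_def)
  qed
  then have "proper_coloring G (card (pverts G)) f"
    using f by (auto simp: proper_coloring_def bij_betw_def)
  then show ?thesis
    unfolding chromatic_number_def by (intro LeastI [of "\<lambda>k. \<exists>c. proper_coloring G k c"] exI)
qed

end

theory Submission
  imports Defs
begin

text \<open>
  If all of \<open>V\<close> were critical, every vertex could be recolored on its own. The vertices of the
  last color class form an independent set, so they could all be recolored simultaneously,
  which would give a proper coloring with \<open>\<chi>(G) - 1\<close> colors.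
\<close>

lemma (in pair_graph) proper_coloring_remove_last_color:
  assumes c: "proper_coloring G k c"
    and recolor: "\<And>v. v \<in> pverts G \<Longrightarrow> \<exists>x. x \<noteq> c v \<and> proper_coloring G k (c(v := x))"
  shows "\<exists>d. proper_coloring G (k - 1) d"
proof -
  obtain g where g: "g v \<noteq> c v" "proper_coloring G k (c(v := g v))" if "v \<in> pverts G" for v
    using recolor by metis
  \<comment> \<open>All vertices of color \<open>k\<close> move to their alternative colors at once.
    Since \<open>g v\<close> differs from \<open>c v\<close>, color \<open>k\<close>
    disappears.\<close>
  define d where "d v = (if c v = k then g v else c v)" for v
  have "d v \<in> {1..k - 1}" if v: "v \<in> pverts G" for v
  proof -
    have "c v \<in> {1..k}" "g v \<in> {1..k}"
      using c g(2)[OF v] v by (auto simp: proper_coloring_def Pi_iff)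
    then show ?thesis
      using g(1)[OF v] by (auto simp: d_def)
  qed
  moreover have "d u \<noteq> d v" if uv: "(u, v) \<in> parcs G" for u v
  proof -
    have verts: "u \<in> pverts G" "v \<in> pverts G" and "u \<noteq> v"
      using uv wellformed' pair_no_loops [OF uv] by auto
    \<comment> \<open>These come from properness of \<open>c\<close>, of \<open>c\<close> recolored
      at \<open>u\<close> only, and of \<open>c\<close> recolored at \<open>v\<close> only. No bound
      between \<open>g u\<close> and \<open>g v\<close> is needed: adjacent vertices never both have
      color \<open>k\<close>, so at most one end of an edge moves.\<close>
    have "c u \<noteq> c v" "g u \<noteq> c v" "c u \<noteq> g v"
      using c g(2)[OF verts(1)] g(2)[OF verts(2)] uv \<open>u \<noteq> v\<close>
      by (fastforce simp: proper_coloring_def)+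
    then show ?thesis
      by (auto simp: d_def)
  qed
  ultimately show ?thesis
    unfolding proper_coloring_def by blast
qed

text \<open>Well-formedness puts both ends of every arc in \<open>pverts G\<close>, so values
  elsewhere are irrelevant.\<close>

lemma proper_coloring_cong:
  assumes "pair_wf_digraph G" "\<And>v. v \<in> pverts G \<Longrightarrow> c v = d v"
  shows "proper_coloring G k c \<longleftrightarrow> proper_coloring G k d"
  using assms(2) pair_wf_digraph.wellformed' [OF assms(1)]
  by (fastforce simp: proper_coloring_def Pi_iff)

theorem proposition4:
  fixes G :: "'a pair_pre_digraph" and c :: "'a \<Rightarrow> nat" and S :: "'a set"
  assumes "pair_graph G"
    and "pverts G \<noteq> {}"
    and "proper_coloring G (chromatic_number G) c"
    and "critical_set G c S"
  shows "card S \<le> card (pverts G) - 1"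
proof -
  interpret pair_graph G by fact
  let ?k = "chromatic_number G"
  have S: "S \<subseteq> pverts G" and minimal: "\<And>T. T \<subset> S \<Longrightarrow> \<not> determining_set G c T"
    using assms(4) by (auto simp: critical_set_def determining_set_def)
  have "S \<noteq> pverts G"
  proof
    assume SV: "S = pverts G"
    have "\<exists>x. x \<noteq> c v \<and> proper_coloring G ?k (c(v := x))" if v: "v \<in> pverts G" for v
    proof -
      have "\<not> determining_set G c (pverts G - {v})"
        using minimal v SV by blast
      then obtain c' where c': "proper_coloring G ?k c'"
        and agree: "\<And>w. w \<in> pverts G - {v} \<Longrightarrow> c' w = c w"
        and differ: "\<exists>w\<in>pverts G. c' w \<noteq> c w"
        by (auto simp: determining_set_def)
      \<comment> \<open>On the vertices \<open>c'\<close> is \<open>c\<close> changed at most at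
        \<open>v\<close>; outside them the two functions may differ, hence the congruence.\<close>
      have "proper_coloring G ?k (c(v := c' v))"
        using c' agree proper_coloring_cong [OF pair_wf_digraph_axioms, of c' "c(v := c' v)"]
        by auto
      moreover have "c' v \<noteq> c v"
        using agree differ by blast
      ultimately show ?thesis
        by blast
    qed
    then have "\<exists>d. proper_coloring G (?k - 1) d"
      using proper_coloring_remove_last_color [OF assms(3)] by blast
    then have "?k \<le> ?k - 1"
      unfolding chromatic_number_def by (rule Least_le)
    \<comment> \<open>Subtraction on \<open>nat\<close> truncates, so \<open>?k \<le> ?k - 1\<close>
      is contradictory only for positive \<open>?k\<close>. Any vertex provides a color in
      \<open>{1..?k}\<close>.\<close>
    moreover have "?k > 0"
      using assms(2,3) by (force simp: proper_coloring_def)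
    ultimately show False
      by simp
  qed
  then have "card S < card (pverts G)"
    using S pair_finite_verts by (simp add: psubset_card_mono psubset_eq)
  then show ?thesis
    by simp
qed

end
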